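(* Let $q$ be an odd prime power. Then the mixed graph $G_q$ (defined in the context, for any admissible choice of $M$) is a mixed graph of diameter $2$ with undirected degree $r=q$, directed degree $z=\frac{q-1}{2}$, and $2q^2$ vertices.
   Context: Mixed graphs. A mixed graph is a finite graph $G$ with vertex set $V(G)$, a set $E(G)$ of (undirected) edges and a set $A(G)$ of arcs (directed edges). Paths may traverse edges in either direction and arcs only in their direction; the distance from $u$ to $v$ is the length of a shortest path from $u$ to $v$ (infinite if there is none), and the diameter is the maximum distance over all ordered pairs of vertices. A mixed (regular) graph has undirected degree $r$ and directed degree $z$ if it is simple and every vertex is incident with exactly $r$ edges and is the initial vertex of exactly $z$ arcs. An arc written $(u,v)$ goes from $u$ to $v$. The graph $B_q$. Let $\mathbb{F}_q$ be the finite field of order $q$. Let $\mathcal{P}$ and $\mathcal{L}$ be two disjoint copies of $\mathbb{F}_q\times\mathbb{F}_q$; elements of $\mathcal{P}$ (points) are written $(x,y)$ and elements of $\mathcal{L}$ (lines) are written $[m,b]$. $B_q$ is the undirected bipartite graph with vertex set $\mathcal{P}\cup\mathcal{L}$ in which $(x,y)$ and $[m,b]$ are adjacent if and only if $y=mx+b$. The graph $G_q$. Let $M\subseteq \mathbb{F}_q\setminus\{0\}$ with $|M|=(q-1)/2$ be such that $u+v\neq 0$ for all $u,v\in M$, and let $-M=\{-u:u\in M\}$. Then $G_q$ is the mixed graph with $V(G_q)=V(B_q)$, $E(G_q)=E(B_q)$ and $A(G_q)=\{([m,b],[m,b+i]): m,b\in\mathbb{F}_q,\ i\in M\}\cup\{((x,y),(x,y+j)):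 x,y\in\mathbb{F}_q,\ j\in -M\}$. *)

theory Defs
  imports Complex_Main "HOL-Library.Extended_Nat" "HOL-Library.Cardinality" "HOL-Number_Theory.Prime_Powers"
begin

text \<open>Edges are unordered pairs, given as vertex sets with one (a loop) or two elements;
  arcs are ordered pairs, directed from the first component to the second.\<close>

record 'v mgraph =
  verts :: "'v set"
  edges :: "'v set set"
  arcs :: "('v \<times> 'v) set"

locale mixed_graph =
  fixes G :: "'v mgraph"
  assumes finite_verts: "finite (verts G)"
    and edges_wf: "e \<in> edges G \<Longrightarrow> e \<subseteq> verts G \<and> (card e = 1 \<or> card e = 2)"
    and arcs_wf: "(u, v) \<in> arcs G \<Longrightarrow> u \<in> verts G \<and> v \<in> verts G"

text \<open>Simple: no loops, and any two vertices are joined by at most one edge or arc. Parallel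
  edges or parallel arcs with the same direction cannot occur since edges and arcs form sets;
  what remains is to exclude an edge parallel to an arc and a pair of opposite arcs.\<close>

locale simple_mixed_graph = mixed_graph +
  assumes no_edge_loop: "{v} \<notin> edges G"
    and no_arc_loop: "(v, v) \<notin> arcs G"
    and no_edge_and_arc: "(u, v) \<in> arcs G \<Longrightarrow> {u, v} \<notin> edges G"
    and no_opposite_arcs: "(u, v) \<in> arcs G \<Longrightarrow> (v, u) \<notin> arcs G"

definition undirected_degree :: "'v mgraph \<Rightarrow> 'v \<Rightarrow> nat" where
  "undirected_degree G v = card {e \<in> edges G. v \<in> e}"

definition directed_degree :: "'v mgraph \<Rightarrow> 'v \<Rightarrow> nat" where
  "directed_degree G v = card {a \<in> arcs G. fst a = v}"

locale mixed_regular_graph = simple_mixed_graph +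
  fixes r z :: nat
  assumes undirected_regular: "v \<in> verts G \<Longrightarrow> undirected_degree G v = r"
    and directed_regular: "v \<in> verts G \<Longrightarrow> directed_degree G v = z"

definition step :: "'v mgraph \<Rightarrow> 'v \<Rightarrow> 'v \<Rightarrow> bool" where
  "step G u v \<longleftrightarrow> {u, v} \<in> edges G \<or> (u, v) \<in> arcs G"

definition is_path :: "'v mgraph \<Rightarrow> 'v \<Rightarrow> 'v list \<Rightarrow> 'v \<Rightarrow> bool" where
  "is_path G u p v \<longleftrightarrow> p \<noteq> [] \<and> hd p = u \<and> last p = v \<and>
     set p \<subseteq> verts G \<and> distinct p \<and> successively (step G) p"

text \<open>A path given by \<open>k + 1\<close> vertices has length \<open>k\<close>. The infimum of the empty set in
  \<^typ>\<open>enat\<close> is \<open>\<infinity>\<close>.\<close>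

definition distance :: "'v mgraph \<Rightarrow> 'v \<Rightarrow> 'v \<Rightarrow> enat" where
  "distance G u v = (INF p \<in> {p. is_path G u p v}. enat (length p - 1))"

definition diameter :: "'v mgraph \<Rightarrow> enat" where
  "diameter G = (SUP (u, v) \<in> verts G \<times> verts G. distance G u v)"

text \<open>\<open>Point x y\<close> stands for the point (x,y) and \<open>Line m b\<close> for the line [m,b].\<close>

datatype 'a point_line = Point 'a 'a | Line 'a 'a

text \<open>The field of order q is given as a finite field type \<open>'a\<close>.\<close>

definition B_graph :: "'a::{field,finite} point_line mgraph" where
  "B_graph =
     \<lparr>verts = {Point x y | x y. True} \<union> {Line m b | m b. True},
      edges = {{Point x y, Line m b} | x y m b. y = m * x + b},
      arcs = {}\<rparr>"

definition admissible :: "'a::{field,finite} set \<Rightarrow> bool" where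
  "admissible M \<longleftrightarrow> M \<subseteq> UNIV - {0} \<and> card M = (CARD('a) - 1) div 2 \<and>
     (\<forall>u\<in>M. \<forall>v\<in>M. u + v \<noteq> 0)"

definition G_graph :: "'a::{field,finite} set \<Rightarrow> 'a point_line mgraph" where
  "G_graph M =
     \<lparr>verts = verts B_graph,
      edges = edges B_graph,
      arcs = {(Line m b, Line m (b + i)) | m b i. i \<in> M} \<union>
             {(Point x y, Point x (y + j)) | x y j. j \<in> uminus ` M}\<rparr>"

end

theory Submission
  imports Defs
begin

text \<open>
  Arcs move a vertex vertically: along its first coordinate \<open>x\<close> or \<open>m\<close>, the second coordinate
  changes by an element of \<open>-M\<close> on points and of \<open>M\<close> on lines. By counting, \<open>M\<close> contains exactly
  one of \<open>d\<close> and \<open>-d\<close> for each \<open>d \<noteq> 0\<close> (it is a half system), and so does \<open>-M\<close>. Any two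
  distinct vertices are within distance 2 for one of three reasons.

  Two points with different first coordinates lie on a common line, and two lines with different
  slopes meet in a point.

  For a point \<open>(x, y)\<close> and a line \<open>[m, b]\<close>, let \<open>d\<close> be the vertical displacement by which the
  starting vertex misses the target. The displacement can be made before or after crossing the edge,
  that is, on points or on lines; one of the two is allowed since \<open>d\<close> lies in \<open>M\<close> or in \<open>-M\<close>.

  Two vertices of the same kind with the same first coordinate have no common neighbour along
  edges, so only arcs can help: one needs that each \<open>d \<noteq> 0\<close> lies in \<open>N\<close> or in \<open>N + N\<close>, for \<open>N = M\<close> and \<open>N = -M\<close>. This
  holds for every half system of a finite abelian group (\<open>half_system_sum_of_two\<close>), because otherwise
  \<open>N \<union> {0}\<close> would be invariant under translation by \<open>-d\<close>.
\<close>

section \<open>Half systems in finite abelian groups\<close>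

definition half_system :: "'a::ab_group_add set \<Rightarrow> bool" where
  "half_system N \<longleftrightarrow> 0 \<notin> N \<and> (\<forall>d. d \<noteq> 0 \<longrightarrow> (- d \<in> N \<longleftrightarrow> d \<notin> N))"

lemma mem_uminus_image_iff: "d \<in> uminus ` N \<longleftrightarrow> - d \<in> N" for d :: "'a::ab_group_add"
  by (metis imageE imageI minus_minus)

lemma half_system_uminus: "half_system N \<Longrightarrow> half_system (uminus ` N)"
  unfolding half_system_def mem_uminus_image_iff by simp

lemma half_system_diff_swap:
  assumes "half_system N" "a - b \<in> N"
  shows "b - a \<notin> N"
  using assms unfolding half_system_def by (metis minus_diff_eq)

text \<open>If \<open>d\<close> were in neither \<open>N\<close> nor \<open>N + N\<close>, then for \<open>a \<in> N\<close> the element \<open>d - a\<close> would be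
  outside \<open>N\<close>, so \<open>a - d \<in> N \<union> {0}\<close>; also \<open>0 - d \<in> N\<close>. Thus translation by \<open>-d\<close> maps the finite
  set \<open>N \<union> {0}\<close> into itself, hence onto itself, and the preimage \<open>d\<close> of \<open>0\<close> lies in \<open>N\<close>.\<close>

lemma half_system_sum_of_two:
  fixes N :: "'a::ab_group_add set"
  assumes "finite N" "half_system N" "d \<noteq> 0" "d \<notin> N"
  shows "\<exists>a\<in>N. d - a \<in> N"
proof (rule ccontr)
  assume none: "\<not> (\<exists>a\<in>N. d - a \<in> N)"
  let ?S = "insert 0 N"
  have "(\<lambda>s. s - d) ` ?S \<subseteq> ?S"
  proof safe
    fix a assume "a \<in> N" "a - d \<notin> N"
    moreover from \<open>a \<in> N\<close> none have "- (a - d) \<notin> N" by auto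
    ultimately show "a - d = 0" using assms(2) unfolding half_system_def by blast
  next
    assume "0 - d \<notin> N"
    then show "0 - d = 0" using assms unfolding half_system_def by simp
  qed
  then have "(\<lambda>s. s - d) ` ?S = ?S"
    using assms(1) by (intro endo_inj_surj) (auto simp: inj_on_def)
  then have "0 \<in> (\<lambda>s. s - d) ` ?S" by auto
  then show False using assms(3,4) by auto
qed

lemma half_system_if_admissible:
  fixes M :: "'a::{field,finite} set"
  assumes "odd CARD('a)" "admissible M"
  shows "half_system M"
proof -
  have no0: "0 \<notin> M" and cM: "card M = (CARD('a) - 1) div 2"
    and nz: "\<And>u v. u \<in> M \<Longrightarrow> v \<in> M \<Longrightarrow> u + v \<noteq> 0"
    using assms(2) unfolding admissible_def by auto
  let ?T = "insert 0 (M \<union> uminus ` M)"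
  have disj: "M \<inter> uminus ` M = {}"
    using nz by (fastforce simp: mem_uminus_image_iff)
  have "0 \<notin> M \<union> uminus ` M" using no0 by auto
  then have "card ?T = Suc (card M + card M)"
    using disj by (simp add: card_Un_disjoint card_image)
  also have "\<dots> = CARD('a)" using assms(1) cM by (auto elim!: oddE)
  finally have "?T = UNIV" by (intro card_subset_eq) auto
  then have "d \<noteq> 0 \<Longrightarrow> d \<in> M \<or> - d \<in> M" for d
    using mem_uminus_image_iff[of d M] by blast
  moreover have "\<not> (d \<in> M \<and> - d \<in> M)" for d using nz[of d "- d"] by auto
  ultimately show ?thesis using no0 unfolding half_system_def by blast
qed

section \<open>Distance and diameter at most two\<close>

text \<open>Paths do not repeat vertices, so a walk of length 2 that starts or ends with a loop has to be
  shortened; the shorter path still satisfies the bound.\<close>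

lemma distance_le_2:
  assumes "u \<in> verts G" "v \<in> verts G" "w \<in> verts G"
    and "u = v \<or> step G u v \<or> (step G u w \<and> step G w v)"
  shows "distance G u v \<le> 2"
proof -
  have "\<exists>p. is_path G u p v \<and> length p \<le> 3"
  proof -
    consider "u = v" | "u \<noteq> v" "step G u v"
      | "distinct [u, w, v]" "step G u w" "step G w v"
      using assms(4) by auto
    then show ?thesis
    proof cases
      case 1
      with assms(1) have "is_path G u [u] v" by (simp add: is_path_def)
      then show ?thesis by fastforce
    next
      case 2
      with assms(1,2) have "is_path G u [u, v] v" by (simp add: is_path_def)
      then show ?thesis by fastforce
    next
      case 3
      with assms(1-3) have "is_path G u [u, w, v] v" by (simp add: is_path_def)
      then show ?thesis by fastforce
    qed
  qed
  then obtain p where p: "is_path G u p v" "length p \<le> 3" by blast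
  then have "distance G u v \<le> enat (length p - 1)"
    unfolding distance_def by (intro INF_lower) simp
  also have "\<dots> \<le> enat 2" using p(2) by simp
  finally show ?thesis by (simp add: numeral_eq_enat)
qed

lemma distance_ge_2:
  assumes "u \<noteq> v" "\<not> step G u v"
  shows "2 \<le> distance G u v"
  unfolding distance_def
proof (rule INF_greatest)
  fix p assume "p \<in> {p. is_path G u p v}"
  then have p: "is_path G u p v" by simp
  have "3 \<le> length p"
  proof (rule ccontr)
    assume "\<not> 3 \<le> length p"
    then have "length p = 0 \<or> length p = 1 \<or> length p = 2" by linarith
    then show False
      using p assms by (auto simp: is_path_def length_Suc_conv numeral_2_eq_2)
  qed
  then have "enat 2 \<le> enat (length p - 1)" by simp
  then show "2 \<le> enat (length p - 1)" by (simp add: numeral_eq_enat)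
qed

lemma diameter_eq_2:
  assumes "\<And>u v. u \<in> verts G \<Longrightarrow> v \<in> verts G \<Longrightarrow> distance G u v \<le> 2"
    and "u \<in> verts G" "v \<in> verts G" "u \<noteq> v" "\<not> step G u v"
  shows "diameter G = 2"
proof (rule antisym)
  show "diameter G \<le> 2"
    unfolding diameter_def using assms(1) by (intro SUP_least) auto
  have "2 \<le> distance G u v" using assms(4,5) by (rule distance_ge_2)
  also have "\<dots> \<le> diameter G"
    unfolding diameter_def using assms(2,3) SUP_upper[of "(u, v)" "verts G \<times> verts G"
        "\<lambda>(u, v). distance G u v"] by simp
  finally show "2 \<le> diameter G" .
qed

section \<open>Adjacency in \<open>G\<^sub>q\<close>\<close>

lemma verts_G_graph: "verts (G_graph M) = UNIV"
proof -
  have "v \<in> verts (G_graph M)" for v :: "'a point_line"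
    by (cases v) (auto simp: G_graph_def B_graph_def)
  then show ?thesis by blast
qed

lemma edges_G_graph:
  "edges (G_graph M) = {{Point x y, Line m b} | x y m b. y = m * x + b}"
  by (simp add: G_graph_def B_graph_def)

lemma edge_G_graph_iff:
  "{Point x y, Line m b} \<in> edges (G_graph M) \<longleftrightarrow> y = m * x + b"
  "{Line m b, Point x y} \<in> edges (G_graph M) \<longleftrightarrow> y = m * x + b"
  "{Point x y, Point x' y'} \<notin> edges (G_graph M)"
  "{Line m b, Line m' b'} \<notin> edges (G_graph M)"
  unfolding edges_G_graph by (auto simp: doubleton_eq_iff)

lemma arc_G_graph_iff:
  "(Point x y, Point x' y') \<in> arcs (G_graph M) \<longleftrightarrow> x' = x \<and> y' - y \<in> uminus ` M"
  "(Line m b, Line m' b') \<in> arcs (G_graph M) \<longleftrightarrow> m' = m \<and> b' - b \<in> M"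
  "(Point x y, Line m b) \<notin> arcs (G_graph M)"
  "(Line m b, Point x y) \<notin> arcs (G_graph M)"
proof -
  have shift: "(\<exists>j. d' = d + j \<and> j \<in> N) \<longleftrightarrow> d' - d \<in> N" for d d' :: 'a and N
    by (metis add_diff_cancel_left' add.commute diff_add_cancel)
  show "(Point x y, Point x' y') \<in> arcs (G_graph M) \<longleftrightarrow> x' = x \<and> y' - y \<in> uminus ` M"
    unfolding shift[symmetric] by (simp add: G_graph_def)
  show "(Line m b, Line m' b') \<in> arcs (G_graph M) \<longleftrightarrow> m' = m \<and> b' - b \<in> M"
    unfolding shift[symmetric] by (simp add: G_graph_def)
qed (simp_all add: G_graph_def)

lemma step_G_graph_iff:
  "step (G_graph M) (Point x y) (Line m b) \<longleftrightarrow> y = m * x + b"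
  "step (G_graph M) (Line m b) (Point x y) \<longleftrightarrow> y = m * x + b"
  "step (G_graph M) (Point x y) (Point x' y') \<longleftrightarrow> x' = x \<and> y' - y \<in> uminus ` M"
  "step (G_graph M) (Line m b) (Line m' b') \<longleftrightarrow> m' = m \<and> b' - b \<in> M"
  unfolding step_def by (simp_all add: edge_G_graph_iff arc_G_graph_iff)

lemma finite_verts_G_graph: "finite (UNIV :: 'a::finite point_line set)"
  and card_verts_G_graph: "CARD('a::finite point_line) = 2 * CARD('a) ^ 2"
proof -
  have U: "(UNIV :: 'a point_line set) = case_prod Point ` UNIV \<union> case_prod Line ` UNIV"
    (is "_ = ?P \<union> ?L")
  proof (intro equalityI subsetI UnCI)
    fix v :: "'a point_line"
    assume "v \<notin> ?L"
    then show "v \<in> ?P" by (cases v) (auto simp: image_iff)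
  qed auto
  show "finite (UNIV :: 'a point_line set)" by (subst U) simp
  have "card ?P = CARD('a) ^ 2" "card ?L = CARD('a) ^ 2"
    by (subst card_image; auto simp: inj_on_def power2_eq_square card_cartesian_product
        simp flip: UNIV_Times_UNIV)+
  moreover have "?P \<inter> ?L = {}" by auto
  ultimately show "CARD('a point_line) = 2 * CARD('a) ^ 2"
    by (subst U, subst card_Un_disjoint) auto
qed

section \<open>Regularity\<close>

lemma undirected_degree_G_graph:
  fixes M :: "'a::{field,finite} set"
  shows "undirected_degree (G_graph M) v = CARD('a)"
proof (cases v)
  case (Point x y)
  have "{e \<in> edges (G_graph M). v \<in> e} = range (\<lambda>m. {Point x y, Line m (y - m * x)})"
    unfolding Point edges_G_graph by (fastforce simp: image_iff doubleton_eq_iff)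
  moreover have "inj (\<lambda>m. {Point x y, Line m (y - m * x)})"
    by (auto simp: inj_def doubleton_eq_iff)
  ultimately show ?thesis by (simp add: undirected_degree_def card_image)
next
  case (Line m b)
  have "{e \<in> edges (G_graph M). v \<in> e} = range (\<lambda>x. {Point x (m * x + b), Line m b})"
    unfolding Line edges_G_graph by (auto simp: image_iff)
  moreover have "inj (\<lambda>x. {Point x (m * x + b), Line m b})"
    by (auto simp: inj_def doubleton_eq_iff)
  ultimately show ?thesis by (simp add: undirected_degree_def card_image)
qed

lemma directed_degree_G_graph:
  fixes M :: "'a::{field,finite} set"
  shows "directed_degree (G_graph M) v = card M"
proof (cases v)
  case (Point x y)
  have "{a \<in> arcs (G_graph M). fst a = v} = (\<lambda>i. (Point x y, Point x (y - i))) ` M"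
    unfolding Point by (auto simp: G_graph_def)
  moreover have "inj_on (\<lambda>i. (Point x y, Point x (y - i))) M"
    by (auto simp: inj_on_def)
  ultimately show ?thesis by (simp add: directed_degree_def card_image)
next
  case (Line m b)
  have "{a \<in> arcs (G_graph M). fst a = v} = (\<lambda>i. (Line m b, Line m (b + i))) ` M"
    unfolding Line by (auto simp: G_graph_def)
  moreover have "inj_on (\<lambda>i. (Line m b, Line m (b + i))) M"
    by (auto simp: inj_on_def)
  ultimately show ?thesis by (simp add: directed_degree_def card_image)
qed

text \<open>Edges join vertices of different kinds and arcs join vertices of the same kind, so they are
  never parallel. Opposite arcs would put
  both \<open>d\<close> and \<open>-d\<close> into \<open>M\<close>, or into \<open>-M\<close>.\<close>

lemma mixed_regular_graph_G_graph:
  fixes M :: "'a::{field,finite} set"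
  assumes M: "half_system M"
  shows "mixed_regular_graph (G_graph M) CARD('a) (card M)"
proof
  show "finite (verts (G_graph M))"
    by (simp add: verts_G_graph finite_verts_G_graph)
  show "e \<subseteq> verts (G_graph M) \<and> (card e = 1 \<or> card e = 2)" if "e \<in> edges (G_graph M)" for e
    using that by (auto simp: verts_G_graph edges_G_graph card_insert_if)
  show "u \<in> verts (G_graph M) \<and> v \<in> verts (G_graph M)" for u v
    by (simp add: verts_G_graph)
  show "{v} \<notin> edges (G_graph M)" for v
    by (auto simp: edges_G_graph)
  show "(v, v) \<notin> arcs (G_graph M)" for v
    using M by (cases v) (auto simp: arc_G_graph_iff half_system_def)
  show "{u, v} \<notin> edges (G_graph M)" if "(u, v) \<in> arcs (G_graph M)" for u v
    using that by (cases u; cases v) (auto simp: arc_G_graph_iff edge_G_graph_iff)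
  show "(v, u) \<notin> arcs (G_graph M)" if "(u, v) \<in> arcs (G_graph M)" for u v
  proof (cases u; cases v)
    fix x y x' y' assume uv: "u = Point x y" "v = Point x' y'"
    show ?thesis
      using that half_system_diff_swap[OF half_system_uminus[OF M]]
      unfolding uv arc_G_graph_iff by blast
  next
    fix m b m' b' assume uv: "u = Line m b" "v = Line m' b'"
    show ?thesis
      using that half_system_diff_swap[OF M]
      unfolding uv arc_G_graph_iff by blast
  qed (use that in \<open>simp_all add: arc_G_graph_iff\<close>)
qed (simp_all add: undirected_degree_G_graph directed_degree_G_graph)

section \<open>The diameter of \<open>G\<^sub>q\<close>\<close>

lemma two_steps_G_graph:
  fixes M :: "'a::{field,finite} set"
  assumes M: "half_system M"
  shows "\<exists>w. u = v \<or> step (G_graph M) u v \<or> (step (G_graph M) u w \<and> step (G_graph M) w v)"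
proof (cases u; cases v)
  fix x y x' y' assume uv: "u = Point x y" "v = Point x' y'"
  show ?thesis
  proof (cases "x = x'")
    case False
    define m where "m = (y' - y) / (x' - x)"
    have "m * (x' - x) = y' - y" using False by (simp add: m_def)
    then have "y' = m * x' + (y - m * x)" by (simp add: algebra_simps)
    then have "step (G_graph M) u (Line m (y - m * x)) \<and> step (G_graph M) (Line m (y - m * x)) v"
      unfolding uv by (simp add: step_G_graph_iff)
    then show ?thesis by blast
  next
    case True
    have "\<exists>a\<in>uminus ` M. y' - y - a \<in> uminus ` M" if "y \<noteq> y'" "y' - y \<notin> uminus ` M"
      using that by (intro half_system_sum_of_two half_system_uminus M) auto
    then consider "y = y'" | "y' - y \<in> uminus ` M"
      | a where "a \<in> uminus ` M" "y' - y - a \<in> uminus ` M"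
      by blast
    then show ?thesis
    proof cases
      case (3 a)
      then have "step (G_graph M) u (Point x (y + a)) \<and> step (G_graph M) (Point x (y + a)) v"
        unfolding uv step_G_graph_iff using True by (simp add: diff_diff_eq)
      then show ?thesis by blast
    qed (use True uv in \<open>simp_all add: step_G_graph_iff\<close>)
  qed
next
  fix m b m' b' assume uv: "u = Line m b" "v = Line m' b'"
  show ?thesis
  proof (cases "m = m'")
    case False
    define x where "x = (b' - b) / (m - m')"
    have "(m - m') * x = b' - b" using False by (simp add: x_def)
    then have "m * x + b = m' * x + b'" by (simp add: algebra_simps)
    then have "step (G_graph M) u (Point x (m * x + b)) \<and> step (G_graph M) (Point x (m * x + b)) v"
      unfolding uv by (simp add: step_G_graph_iff)
    then show ?thesis by blast
  next
    case True
    have "\<exists>a\<in>M. b' - b - a \<in> M" if "b \<noteq> b'" "b' - b \<notin> M"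
      using that by (intro half_system_sum_of_two M) auto
    then consider "b = b'" | "b' - b \<in> M" | a where "a \<in> M" "b' - b - a \<in> M"
      by blast
    then show ?thesis
    proof cases
      case (3 a)
      then have "step (G_graph M) u (Line m (b + a)) \<and> step (G_graph M) (Line m (b + a)) v"
        unfolding uv step_G_graph_iff using True by (simp add: diff_diff_eq)
      then show ?thesis by blast
    qed (use True uv in \<open>simp_all add: step_G_graph_iff\<close>)
  qed
next
  fix x y m b assume uv: "u = Point x y" "v = Line m b"
  define d where "d = m * x + b - y"
  \<comment> \<open>Shift the point onto the target line, or take the parallel line through the point and shift
    that line.\<close>
  consider "d = 0" | "d \<in> uminus ` M" | "d \<in> M"
    using M unfolding half_system_def mem_uminus_image_iff by blast
  then show ?thesis
  proof cases
    case 1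
    then show ?thesis unfolding uv by (simp add: step_G_graph_iff d_def)
  next
    case 2
    then have "step (G_graph M) u (Point x (m * x + b)) \<and> step (G_graph M) (Point x (m * x + b)) v"
      unfolding uv by (simp add: step_G_graph_iff d_def)
    then show ?thesis by blast
  next
    case 3
    then have "step (G_graph M) u (Line m (y - m * x)) \<and> step (G_graph M) (Line m (y - m * x)) v"
      unfolding uv by (simp add: step_G_graph_iff d_def algebra_simps)
    then show ?thesis by blast
  qed
next
  fix m b x y assume uv: "u = Line m b" "v = Point x y"
  define d where "d = y - (m * x + b)"
  \<comment> \<open>The arcs are now taken at the other end: cross to the point of the line with the right
    abscissa and move it to the target, or shift the line onto the target before crossing.\<close>
  consider "d = 0" | "d \<in> uminus ` M" | "d \<in> M"
    using M unfolding half_system_def mem_uminus_image_iff by blast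
  then show ?thesis
  proof cases
    case 1
    then show ?thesis unfolding uv by (simp add: step_G_graph_iff d_def)
  next
    case 2
    then have "step (G_graph M) u (Point x (m * x + b)) \<and> step (G_graph M) (Point x (m * x + b)) v"
      unfolding uv by (simp add: step_G_graph_iff d_def)
    then show ?thesis by blast
  next
    case 3
    then have "step (G_graph M) u (Line m (y - m * x)) \<and> step (G_graph M) (Line m (y - m * x)) v"
      unfolding uv by (simp add: step_G_graph_iff d_def algebra_simps)
    then show ?thesis by blast
  qed
qed

lemma diameter_G_graph:
  fixes M :: "'a::{field,finite} set"
  assumes "half_system M"
  shows "diameter (G_graph M) = 2"
proof (rule diameter_eq_2)
  show "distance (G_graph M) u v \<le> 2" for u v
    using two_steps_G_graph[OF assms, of u v] distance_le_2[of u "G_graph M" v]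
    by (auto simp: verts_G_graph)
  show "\<not> step (G_graph M) (Point 0 0) (Point 1 0)"
    by (simp add: step_G_graph_iff)
qed (simp_all add: verts_G_graph)

theorem corollary3p1:
  fixes q :: nat and M :: "'a::{field,finite} set"
  assumes "primepow q" and "odd q" and "CARD('a) = q" and "admissible M"
  shows "mixed_regular_graph (G_graph M) q ((q - 1) div 2) \<and>
         diameter (G_graph M) = 2 \<and>
         card (verts (G_graph M)) = 2 * q ^ 2"
proof -
  have M: "half_system M"
    using assms(2-4) by (intro half_system_if_admissible) simp_all
  have "card M = (q - 1) div 2"
    using assms(3,4) by (simp add: admissible_def)
  then show ?thesis
    using mixed_regular_graph_G_graph[OF M] diameter_G_graph[OF M] assms(3)
    by (simp add: verts_G_graph card_verts_G_graph)
qed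

end
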